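(* Let $(X_n)_{n\in\mathbb{N}_0}$ be a transient random walk on a regular language over the finite alphabet $\mathcal{A}$ which is weakly symmetric and suffix-irreducible. Let $h=\lim_{n\to\infty}-\frac1n\mathbb{E}[\log\pi_n(X_n)]$ be its asymptotic entropy ($\pi_n$ the distribution of $X_n$) and $\ell$ its rate of escape with respect to word length. Then $$h\le\ell\cdot\log|\mathcal{A}|.$$
   Context: $\mathcal{A}$ is a finite alphabet, $\mathcal{A}^n$ the set of words with exactly $n$ letters, $\mathcal{A}^*$ the set of all finite words including the empty word $o$, and $|w|$ the length of $w$. A random walk on a regular language is a time-homogeneous Markov chain $(X_n)_{n\ge0}$ on $\mathcal{A}^*$ with $X_0=o$ whose only possible one-step transitions are (for $w\in\mathcal{A}^*$ and letters $a_i,b_i\in\mathcal{A}$): from $wa_1a_2$ to $wb_1$, $wb_1b_2$, $wb_1b_2b_3$ with probabilities $p(a_1a_2,b_1)$, $p(a_1a_2,b_1b_2)$, $p(a_1a_2,b_1b_2b_3)$ not depending on $w$; from $a_1$ to $o$, $b_1$, $b_1b_2$ with probabilities $p(a_1,o)$, $p(a_1,b_1)$, $p(a_1,b_1b_2)$; from $o$ to $o$, $b_1$ with probabilities $p(o,o)$, $p(o,b_1)$. $\mathbb{P}_w$ is the law started at $w$ and $\mathcal{L}=\{w:\exists n\in\mathbb{N},\ \mathbb{P}[X_n=w]>0\}$. Weakly symmetric: for all $u,v\in\mathcal{A}^*$, $\mathbb{P}_u[X_1=v]>0$ implies $\mathbb{P}_v[X_1=u]>0$. Suffix-irreducible: for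 every $w=w_0a_0b_0\in\mathcal{L}$ ($w_0\in\mathcal{A}^*$, $a_0b_0\in\mathcal{A}^2$) and every $ab\in\mathcal{A}^2$ there are $n\in\mathbb{N}$, $w_1\in\mathcal{A}^*$ with $\mathbb{P}_w[X_n=w_0w_1ab,\ \forall k\le n:|X_k|\ge|w|]>0$. Under these assumptions and transience the limit $h$ exists; the rate of escape $\ell$ is the almost sure constant limit of $|X_n|/n$, which exists. *)

theory Defs
  imports "HOL-Probability.Probability"
begin

text \<open>
  The alphabet is the finite type \<open>'a\<close>, words are lists over it, and \<open>[]\<close> is the empty word.
  A walk acts on the suffix of length (at most) two of the current word. The data \<open>p s b\<close> is the
  probability of replacing the suffix \<open>s\<close> by the word \<open>b\<close>.
\<close>

text \<open>
  The three kinds of replacements coincide with \<open>\<bar>length b - length s\<bar> \<le> 1\<close>: a suffix of length two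
  is replaced by 1, 2 or 3 letters, a single letter by 0, 1 or 2 letters, and the empty word
  by 0 or 1 letters.
\<close>

definition replacements :: "'a list \<Rightarrow> 'a list set" where
  "replacements s = {b. length b \<le> length s + 1 \<and> length s \<le> length b + 1}"

definition replacement_probs :: "('a::finite list \<Rightarrow> 'a list \<Rightarrow> real) \<Rightarrow> bool" where
  "replacement_probs p \<longleftrightarrow>
     (\<forall>s. length s \<le> 2 \<longrightarrow>
        (\<forall>b\<in>replacements s. 0 \<le> p s b) \<and> (\<Sum>b\<in>replacements s. p s b) = 1)"

text \<open>
  The word \<open>u\<close> is split as prefix and suffix at position \<open>length u - 2\<close>; for words with fewer than
  two letters truncated subtraction makes the prefix empty and the suffix all of \<open>u\<close>.
\<close>

definition trans_prob :: "('a list \<Rightarrow> 'a list \<Rightarrow> real) \<Rightarrow> 'a list \<Rightarrow> 'a list \<Rightarrow> real" where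
  "trans_prob p u v =
     (let k = length u - 2
      in if take k v = take k u \<and> drop k v \<in> replacements (drop k u)
         then p (drop k u) (drop k v) else 0)"

lemma finite_replacements: "finite (replacements (s :: 'a::finite list))"
proof (rule finite_subset)
  show "replacements s \<subseteq> {b. set b \<subseteq> UNIV \<and> length b \<le> length s + 1}"
    by (auto simp: replacements_def)
  show "finite {b :: 'a list. set b \<subseteq> UNIV \<and> length b \<le> length s + 1}"
    by (rule finite_lists_length_le) simp
qed

lemma trans_prob_long:
  "trans_prob p (w @ [a1, a2]) v =
     (if \<exists>b. v = w @ b \<and> length b \<in> {1, 2, 3} then p [a1, a2] (drop (length w) v) else 0)"
proof -
  have "(take (length w) v = w) = (\<exists>b. v = w @ b)"
    by (metis append_eq_conv_conj append_take_drop_id)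
  then show ?thesis
    by (auto simp: trans_prob_def replacements_def Let_def)
qed

lemma trans_prob_singleton:
  "trans_prob p [a] v = (if length v \<le> 2 then p [a] v else 0)"
  by (auto simp: trans_prob_def replacements_def)

lemma trans_prob_Nil:
  "trans_prob p [] v = (if length v \<le> 1 then p [] v else 0)"
  by (auto simp: trans_prob_def replacements_def)

text \<open>
  \<open>P w\<close> is the law of the walk \<open>X\<close> started at \<open>w\<close>. The Markov property is stated in product form, so
  that no conditioning on null events occurs.
\<close>

definition regular_language_walk ::
  "('a::finite list \<Rightarrow> 'a list \<Rightarrow> real) \<Rightarrow> ('a list \<Rightarrow> 'w measure) \<Rightarrow> (nat \<Rightarrow> 'w \<Rightarrow> 'a list) \<Rightarrow> bool"
  where
  "regular_language_walk p P X \<longleftrightarrow>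
     replacement_probs p \<and>
     (\<forall>w. prob_space (P w)
        \<and> (\<forall>n. X n \<in> measurable (P w) (count_space UNIV))
        \<and> \<P>(\<omega> in P w. X 0 \<omega> = w) = 1
        \<and> (\<forall>n x v. \<P>(\<omega> in P w. (\<forall>k\<le>n. X k \<omega> = x k) \<and> X (Suc n) \<omega> = v)
                  = \<P>(\<omega> in P w. \<forall>k\<le>n. X k \<omega> = x k) * trans_prob p (x n) v))"

definition reachable_words ::
  "('a list \<Rightarrow> 'w measure) \<Rightarrow> (nat \<Rightarrow> 'w \<Rightarrow> 'a list) \<Rightarrow> 'a list set" where
  "reachable_words P X = {w. \<exists>n. \<P>(\<omega> in P []. X n \<omega> = w) > 0}"

definition transient_walk ::
  "('a list \<Rightarrow> 'w measure) \<Rightarrow> (nat \<Rightarrow> 'w \<Rightarrow> 'a list) \<Rightarrow> bool" where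
  "transient_walk P X \<longleftrightarrow>
     (\<forall>w\<in>reachable_words P X. \<P>(\<omega> in P w. \<exists>n\<ge>1. X n \<omega> = w) < 1)"

definition weakly_symmetric ::
  "('a list \<Rightarrow> 'w measure) \<Rightarrow> (nat \<Rightarrow> 'w \<Rightarrow> 'a list) \<Rightarrow> bool" where
  "weakly_symmetric P X \<longleftrightarrow>
     (\<forall>u v. \<P>(\<omega> in P u. X 1 \<omega> = v) > 0 \<longrightarrow> \<P>(\<omega> in P v. X 1 \<omega> = u) > 0)"

definition suffix_irreducible ::
  "('a list \<Rightarrow> 'w measure) \<Rightarrow> (nat \<Rightarrow> 'w \<Rightarrow> 'a list) \<Rightarrow> bool" where
  "suffix_irreducible P X \<longleftrightarrow>
     (\<forall>w w0 a0 b0 a b. w = w0 @ [a0, b0] \<and> w \<in> reachable_words P X \<longrightarrow>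
        (\<exists>n w1. \<P>(\<omega> in P w. X n \<omega> = w0 @ w1 @ [a, b] \<and>
                              (\<forall>k\<le>n. length (X k \<omega>) \<ge> length w)) > 0))"

text \<open>\<open>step_dist P X n\<close> is the distribution of \<open>X n\<close> for the walk started at the empty word.\<close>

definition step_dist ::
  "('a list \<Rightarrow> 'w measure) \<Rightarrow> (nat \<Rightarrow> 'w \<Rightarrow> 'a list) \<Rightarrow> nat \<Rightarrow> 'a list \<Rightarrow> real" where
  "step_dist P X n w = \<P>(\<omega> in P []. X n \<omega> = w)"

end

theory Submission
  imports Defs "HOL-Real_Asymp.Real_Asymp"
begin

text \<open>
  The bound is a counting argument at each fixed time. In one step the word length grows by at
  most one, so \<open>X n\<close> lives on the finitely many words of length at most \<open>n\<close> (lemma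
  \<open>walk_length_le\<close>). To describe such a word one may first name its length, which costs at most
  \<open>ln (n + 1)\<close>, and then its letters, which costs \<open>ln CARD('a)\<close> each. Hence the Shannon entropy
  of \<open>X n\<close> is at most \<open>ln (n + 1) + E[length (X n)] * ln CARD('a)\<close> (lemma \<open>word_entropy_le\<close>). The
  description corresponds to the probability weights \<open>1 / ((n + 1) * CARD('a) ^ length w)\<close>, with
  which the law of \<open>X n\<close> is compared through Gibbs' inequality.

  After division by \<open>n\<close> the first summand disappears in the limit. The variables
  \<open>length (X n) / n\<close> are bounded by one, so their almost sure convergence to the rate of escape
  carries over to the expectations by dominated convergence.
\<close>

section \<open>Entropy of random words of bounded length\<close>

text \<open>
  Summed over the outcomes, \<open>ln t \<le> t - 1\<close> at \<open>t = q w / r w\<close> compares the entropy of \<open>r\<close> with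
  the expected code length under \<open>q\<close>. Outcomes with \<open>r w = 0\<close> contribute nothing to either side,
  because \<open>ln 0\<close> is multiplied by zero.
\<close>

lemma gibbs_inequality:
  fixes r q :: "'b \<Rightarrow> real"
  assumes "\<And>w. w \<in> S \<Longrightarrow> 0 \<le> r w" and "\<And>w. w \<in> S \<Longrightarrow> 0 < q w"
    and "sum q S \<le> sum r S"
  shows "- (\<Sum>w\<in>S. r w * ln (r w)) \<le> - (\<Sum>w\<in>S. r w * ln (q w))"
proof -
  have pointwise: "r w * ln (q w) - r w * ln (r w) \<le> q w - r w" if "w \<in> S" for w
  proof (cases "r w = 0")
    case True
    then show ?thesis using assms(2)[OF that] by simp
  next
    case False
    then have pos: "0 < r w" "0 < q w" using assms(1,2)[OF that] by auto
    then have "ln (q w) - ln (r w) \<le> q w / r w - 1"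
      using ln_le_minus_one[of "q w / r w"] by (simp add: ln_div)
    then have "r w * (ln (q w) - ln (r w)) \<le> r w * (q w / r w - 1)"
      using pos by (intro mult_left_mono) auto
    then show ?thesis using pos by (simp add: algebra_simps)
  qed
  have "(\<Sum>w\<in>S. r w * ln (q w) - r w * ln (r w)) \<le> (\<Sum>w\<in>S. q w - r w)"
    by (rule sum_mono) (rule pointwise)
  then show ?thesis using assms(3) by (simp add: sum_subtractf)
qed

lemma finite_words_length_le: "finite {w :: 'a::finite list. length w \<le> n}"
  using finite_lists_length_le[of "UNIV :: 'a set" n] by simp

text \<open>Each of the \<open>n + 1\<close> possible lengths carries the total weight one.\<close>

lemma sum_inverse_power_length:
  "(\<Sum>w\<in>{w :: 'a::finite list. length w \<le> n}. 1 / real CARD('a) ^ length w) = real (n + 1)"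
proof -
  have "(\<Sum>w\<in>{w :: 'a list. length w \<le> n}. 1 / real CARD('a) ^ length w)
      = (\<Sum>k\<le>n. \<Sum>w\<in>{w :: 'a list. w \<in> {w. length w \<le> n} \<and> length w = k}.
            1 / real CARD('a) ^ length w)"
    by (rule sum.group[symmetric]) (auto simp: finite_words_length_le)
  also have "\<dots> = (\<Sum>k\<le>n. 1)"
  proof (rule sum.cong[OF refl])
    fix k assume "k \<in> {..n}"
    then have eq: "{w :: 'a list. w \<in> {w. length w \<le> n} \<and> length w = k} = {w. length w = k}"
      by auto
    have "card {w :: 'a list. length w = k} = CARD('a) ^ k"
      using card_lists_length_eq[of "UNIV :: 'a set" k] by simp
    then show "(\<Sum>w\<in>{w :: 'a list. w \<in> {w. length w \<le> n} \<and> length w = k}.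
        1 / real CARD('a) ^ length w) = 1"
      unfolding eq by simp
  qed
  finally show ?thesis by simp
qed

lemma word_entropy_le:
  fixes r :: "'a::finite list \<Rightarrow> real" and n :: nat
  defines "S \<equiv> {w. length w \<le> n}"
  assumes "\<And>w. w \<in> S \<Longrightarrow> 0 \<le> r w" and total: "sum r S = 1"
  shows "- (\<Sum>w\<in>S. r w * ln (r w))
    \<le> ln (real (n + 1)) + (\<Sum>w\<in>S. r w * real (length w)) * ln (real CARD('a))"
proof -
  define q :: "'a list \<Rightarrow> real"
    where "q w = 1 / real CARD('a) ^ length w / real (n + 1)" for w
  have pos: "0 < q w" for w by (simp add: q_def)
  have ln_q: "ln (q w) = - (ln (real (n + 1)) + real (length w) * ln (real CARD('a)))" for w
    unfolding q_def by (simp add: ln_div ln_realpow ln_mult del: of_nat_add of_nat_Suc)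
  have "sum q S = 1"
    unfolding q_def sum_divide_distrib[symmetric] S_def sum_inverse_power_length by simp
  then have "- (\<Sum>w\<in>S. r w * ln (r w)) \<le> - (\<Sum>w\<in>S. r w * ln (q w))"
    using assms(2) total pos by (intro gibbs_inequality) auto
  also have "\<dots> = (\<Sum>w\<in>S. r w * ln (real (n + 1)) + r w * real (length w) * ln (real CARD('a)))"
    unfolding sum_negf[symmetric]
    by (intro sum.cong refl) (simp add: ln_q algebra_simps)
  also have "\<dots> = ln (real (n + 1)) + (\<Sum>w\<in>S. r w * real (length w)) * ln (real CARD('a))"
    by (simp add: sum.distrib sum_distrib_right[symmetric] total)
  finally show ?thesis .
qed

lemma (in prob_space) expectation_finite_valued:
  fixes f :: "'b \<Rightarrow> real"
  assumes Y: "Y \<in> measurable M (count_space UNIV)"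
    and "finite S" and "AE \<omega> in M. Y \<omega> \<in> S"
  shows "expectation (\<lambda>\<omega>. f (Y \<omega>)) = (\<Sum>w\<in>S. \<P>(\<omega> in M. Y \<omega> = w) * f w)"
proof -
  have event: "{\<omega>\<in>space M. Y \<omega> = w} \<in> events" for w
    using measurable_sets[OF Y, of "{w}"] by (simp add: vimage_def Int_def conj_commute)
  have Yf: "(\<lambda>\<omega>. f (Y \<omega>)) \<in> borel_measurable M"
    by (rule measurable_compose[OF Y]) simp
  have "expectation (\<lambda>\<omega>. f (Y \<omega>))
      = expectation (\<lambda>\<omega>. \<Sum>w\<in>S. indicator {\<omega>\<in>space M. Y \<omega> = w} \<omega> * f w)"
  proof (rule integral_cong_AE)
    show "AE \<omega> in M. f (Y \<omega>) = (\<Sum>w\<in>S. indicator {\<omega>\<in>space M. Y \<omega> = w} \<omega> * f w)"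
      using assms(3) AE_space
    proof eventually_elim
      case (elim \<omega>)
      have "(\<Sum>w\<in>S. indicator {\<omega>\<in>space M. Y \<omega> = w} \<omega> * f w)
          = (\<Sum>w\<in>S. if Y \<omega> = w then f w else 0)"
        using elim by (intro sum.cong) (auto simp: indicator_def)
      then show ?case using elim \<open>finite S\<close> by (simp add: sum.delta')
    qed
  qed (use Yf event in measurable)
  also have "\<dots> = (\<Sum>w\<in>S. \<P>(\<omega> in M. Y \<omega> = w) * f w)"
    using event by (subst Bochner_Integration.integral_sum) (auto simp: emeasure_eq_measure)
  finally show ?thesis .
qed

section \<open>Growth of the word length\<close>

lemma trans_prob_eq_0_of_length:
  "length u + 1 < length v \<Longrightarrow> trans_prob p u v = 0"
  by (auto simp: trans_prob_def replacements_def Let_def)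

text \<open>
  The Markov property speaks about single paths only. Since there are countably many words, a
  path prefix takes countably many values, and those with a forbidden last step form a null set.
\<close>

lemma walk_length_step:
  fixes p :: "'a::finite list \<Rightarrow> 'a list \<Rightarrow> real"
  assumes walk: "regular_language_walk p P X"
  shows "AE \<omega> in P w. length (X (Suc n) \<omega>) \<le> length (X n \<omega>) + 1"
proof -
  interpret prob_space "P w" using walk by (simp add: regular_language_walk_def)
  have X: "X k \<in> measurable (P w) (count_space UNIV)" for k
    using walk by (simp add: regular_language_walk_def)
  have markov: "\<P>(\<omega> in P w. (\<forall>k\<le>n. X k \<omega> = x k) \<and> X (Suc n) \<omega> = v)
      = \<P>(\<omega> in P w. \<forall>k\<le>n. X k \<omega> = x k) * trans_prob p (x n) v" for x v
    using walk unfolding regular_language_walk_def by blast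
  have null: "AE \<omega> in P w. \<not> ((\<forall>k\<le>n. X k \<omega> = x k) \<and> X (Suc n) \<omega> = v)"
    if "length (x n) + 1 < length v" for x v
  proof -
    have "{\<omega>\<in>space (P w). (\<forall>k\<le>n. X k \<omega> = x k) \<and> X (Suc n) \<omega> = v} \<in> events"
      using X by measurable
    moreover have "\<P>(\<omega> in P w. (\<forall>k\<le>n. X k \<omega> = x k) \<and> X (Suc n) \<omega> = v) = 0"
      unfolding markov trans_prob_eq_0_of_length[OF that] by simp
    ultimately show ?thesis by (subst prob_Collect_eq_0[symmetric])
  qed
  have "AE \<omega> in P w. \<forall>xs v. length (xs ! n) + 1 < length v \<longrightarrow>
      \<not> ((\<forall>k\<le>n. X k \<omega> = xs ! k) \<and> X (Suc n) \<omega> = v)"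
    unfolding AE_all_countable
  proof (intro allI)
    fix xs :: "'a list list" and v
    show "AE \<omega> in P w. length (xs ! n) + 1 < length v \<longrightarrow>
        \<not> ((\<forall>k\<le>n. X k \<omega> = xs ! k) \<and> X (Suc n) \<omega> = v)"
      using null[of "(!) xs" v] by (cases "length (xs ! n) + 1 < length v") simp_all
  qed
  then show ?thesis
  proof eventually_elim
    case (elim \<omega>)
    let ?xs = "map (\<lambda>k. X k \<omega>) [0..<Suc n]"
    have nth: "?xs ! k = X k \<omega>" if "k \<le> n" for k using that by (simp del: upt_Suc)
    then have "\<not> length (?xs ! n) + 1 < length (X (Suc n) \<omega>)"
      using elim by metis
    then show ?case unfolding nth[OF order.refl] by simp
  qed
qed

lemma walk_length_le:
  fixes p :: "'a::finite list \<Rightarrow> 'a list \<Rightarrow> real"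
  assumes walk: "regular_language_walk p P X"
  shows "AE \<omega> in P w. length (X n \<omega>) \<le> length w + n"
proof (induction n)
  case 0
  interpret prob_space "P w" using walk by (simp add: regular_language_walk_def)
  have "X 0 \<in> measurable (P w) (count_space UNIV)"
    using walk by (simp add: regular_language_walk_def)
  then have "{\<omega>\<in>space (P w). X 0 \<omega> = w} \<in> events" by measurable
  moreover have "\<P>(\<omega> in P w. X 0 \<omega> = w) = 1"
    using walk by (simp add: regular_language_walk_def)
  ultimately have "AE \<omega> in P w. X 0 \<omega> = w" by (subst prob_Collect_eq_1[symmetric])
  then show ?case by eventually_elim simp
next
  case (Suc n)
  with walk_length_step[OF walk, of n w] show ?case by eventually_elim simp
qed

section \<open>Entropy and rate of escape\<close>

lemma step_dist_nonneg: "0 \<le> step_dist P X n w"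
  by (simp add: step_dist_def)

lemma walk_entropy_le:
  fixes p :: "'a::finite list \<Rightarrow> 'a list \<Rightarrow> real"
  assumes walk: "regular_language_walk p P X"
  shows "- (\<integral>\<omega>. ln (step_dist P X n (X n \<omega>)) \<partial>P [])
    \<le> ln (real (n + 1)) + (\<integral>\<omega>. real (length (X n \<omega>)) \<partial>P []) * ln (real CARD('a))"
proof -
  interpret prob_space "P []" using walk by (simp add: regular_language_walk_def)
  let ?S = "{w :: 'a list. length w \<le> n}"
  have X: "X n \<in> measurable (P []) (count_space UNIV)"
    using walk by (simp add: regular_language_walk_def)
  have short: "AE \<omega> in P []. X n \<omega> \<in> ?S" using walk_length_le[OF walk, of n "[]"] by simp
  have expect: "expectation (\<lambda>\<omega>. f (X n \<omega>)) = (\<Sum>w\<in>?S. step_dist P X n w * f w)"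
    for f :: "'a list \<Rightarrow> real"
    unfolding step_dist_def by (rule expectation_finite_valued[OF X finite_words_length_le short])
  have "(\<Sum>w\<in>?S. step_dist P X n w) = 1" using expect[of "\<lambda>_. 1"] by (simp add: prob_space)
  then show ?thesis
    using word_entropy_le[of n "step_dist P X n"]
    by (simp add: step_dist_nonneg expect[of "\<lambda>w. real (length w)"]
        expect[of "\<lambda>w. ln (step_dist P X n w)"])
qed

lemma mean_speed_tendsto:
  fixes p :: "'a::finite list \<Rightarrow> 'a list \<Rightarrow> real"
  assumes walk: "regular_language_walk p P X"
    and escape: "AE \<omega> in P []. (\<lambda>n. real (length (X n \<omega>)) / real n) \<longlonglongrightarrow> l"
  shows "(\<lambda>n. (\<integral>\<omega>. real (length (X n \<omega>)) \<partial>P []) / real n) \<longlonglongrightarrow> l"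
proof -
  interpret prob_space "P []" using walk by (simp add: regular_language_walk_def)
  have X: "X n \<in> measurable (P []) (count_space UNIV)" for n
    using walk by (simp add: regular_language_walk_def)
  have "(\<lambda>n. \<integral>\<omega>. real (length (X n \<omega>)) / real n \<partial>P []) \<longlonglongrightarrow> (\<integral>\<omega>. l \<partial>P [])"
  proof (rule integral_dominated_convergence[where w = "\<lambda>_. 1"])
    fix n
    show "(\<lambda>\<omega>. real (length (X n \<omega>)) / real n) \<in> borel_measurable (P [])"
      by (rule measurable_compose[OF X]) simp
    show "AE \<omega> in P []. norm (real (length (X n \<omega>)) / real n) \<le> 1"
      using walk_length_le[OF walk, of n "[]"] by eventually_elim (auto simp: divide_le_eq_1)
  qed (use escape in auto)
  then show ?thesis by (simp add: prob_space)
qed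

theorem theorem7p3:
  fixes p :: "'a::finite list \<Rightarrow> 'a list \<Rightarrow> real"
    and P :: "'a list \<Rightarrow> 'w measure"
    and X :: "nat \<Rightarrow> 'w \<Rightarrow> 'a list"
    and h l :: real
  assumes walk: "regular_language_walk p P X"
    and transient: "transient_walk P X"
    and symmetric: "weakly_symmetric P X"
    and irreducible: "suffix_irreducible P X"
    and entropy: "(\<lambda>n. - (1 / real n) * (\<integral>\<omega>. ln (step_dist P X n (X n \<omega>)) \<partial>P [])) \<longlonglongrightarrow> h"
    and escape: "AE \<omega> in P []. (\<lambda>n. real (length (X n \<omega>)) / real n) \<longlonglongrightarrow> l"
  shows "h \<le> l * ln (real CARD('a))"
proof -
  let ?E = "\<lambda>n. \<integral>\<omega>. real (length (X n \<omega>)) \<partial>P []"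
  have "(\<lambda>n. ln (real (n + 1)) / real n) \<longlonglongrightarrow> 0" by real_asymp
  then have "(\<lambda>n. ln (real (n + 1)) / real n + ?E n / real n * ln (real CARD('a)))
      \<longlonglongrightarrow> 0 + l * ln (real CARD('a))"
    by (intro tendsto_add tendsto_mult tendsto_const mean_speed_tendsto[OF walk escape])
  moreover have "- (1 / real n) * (\<integral>\<omega>. ln (step_dist P X n (X n \<omega>)) \<partial>P [])
      \<le> ln (real (n + 1)) / real n + ?E n / real n * ln (real CARD('a))" for n
    using divide_right_mono[OF walk_entropy_le[OF walk, of n], of "real n"]
    by (simp add: add_divide_distrib)
  ultimately have "h \<le> 0 + l * ln (real CARD('a))"
    by (intro LIMSEQ_le[OF entropy]) auto
  then show ?thesis by simp
qed

end
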